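(* Let $(k_n)_{n\in\mathbb N}$ be a sequence of integers with $1\le k_n\le n$ and $k_n=\omega(1)$, and let $(\xi_n)_{n\in\mathbb N}$ be a sequence of isotropic log-concave random vectors, $\xi_n$ taking values in $\mathbb R^{k_n}$. Suppose that the sequence of random variables $X_n=\frac{\|\xi_n\|_2}{\sqrt{k_n}}$, $n\in\mathbb N$, satisfies a large deviations principle on $\mathbb R$ with speed $s_n$ and rate function $\mathbb I:\mathbb R\to[0,\infty]$. Assume that one of the following two conditions is satisfied: (a) $s_n=o(\sqrt{k_n})$ and $\mathbb I$ is non-singular, i.e. $\mathbb I\neq\mathbb I_0$, where $\mathbb I_0(1)=0$ and $\mathbb I_0(x)=+\infty$ for $x\neq 1$; (b) $s_n\approx\sqrt{k_n}$ and $\displaystyle\inf_{t>t_0}\frac{\inf_{x\in(t,\infty)}\mathbb I(x)}{t}=0$ for some constant $t_0\in(1,\infty)$. Then the KLS conjecture is false.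
   Context: KLS conjecture: the assertion that there exists an absolute constant $C\in(0,\infty)$ such that for all $n\in\mathbb N$, every centered random vector $X$ in $\mathbb R^n$ with log-concave distribution, and every locally Lipschitz function $f:\mathbb R^n\to\mathbb R$ such that $f(X)$ has finite variance, $$\mathrm{Var}[f(X)]\le C\,\lambda_X^2\,\mathbb E\big[\|\nabla f(X)\|_2^2\big],\qquad \lambda_X^2:=\sup_{\theta\in\mathbb S^{n-1}}\mathbb E\langle X,\theta\rangle^2 .$$ A random vector is isotropic if it is centered and its covariance matrix is the identity. $\|\cdot\|_2$ is the Euclidean norm. Large deviations principle (LDP): given a sequence $(s_n)$ of positive reals, a sequence of random vectors $(X_n)$ in $\mathbb R^d$ satisfies an LDP with speed $s_n$ and rate function $\mathbb I:\mathbb R^d\to[0,\infty]$ if $\mathbb I$ is lower semi-continuous with compact level sets $\{x:\mathbb I(x)\le\alpha\}$, $\alpha\in\mathbb R$, and for all Borel sets $A\subseteq\mathbb R^d$ $$-\inf_{x\in A^\circ}\mathbb I(x)\le\liminf_{n\to\infty}s_n^{-1}\log\mathbb P[X_n\in A]\le\limsup_{n\to\infty}s_n^{-1}\log\mathbb P[X_n\in A]\le-\inf_{x\in\overline A}\mathbb I(x),$$ where $A^\circ$ and $\overline A$ are the interior and closure of $A$ (with $\log 0=-\infty$, $\inf\emptyset=+\infty$). Landau notation: $x_n=o(y_n)$ means $\lim x_n/y_n=0$; $x_n=\omega(y_n)$ means $\lim|x_n/y_n|=+\infty$; $x_n\approx y_n$ means there are constants $c_1,c_2\in(0,\infty)$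 with $c_1x_n\le y_n\le c_2x_n$ for all $n$. *)

theory Defs
  imports "HOL-Probability.Probability" "HOL-Library.Landau_Symbols"
begin

text \<open>
  The dimension has to be quantified inside formulas, so \<open>R^n\<close> is the product of \<open>n\<close> copies of the
  real line over the index set \<open>{..<n}\<close>, carrying Lebesgue measure. Its points are the extensional
  functions on \<open>{..<n}\<close>; the Euclidean norm of \<open>x\<close> is \<open>L2_set x {..<n}\<close>. Probability laws on \<open>R^n\<close>
  live on the same (Borel) sigma-algebra.
\<close>

definition lebesgue_Rn :: "nat \<Rightarrow> (nat \<Rightarrow> real) measure" where
  "lebesgue_Rn n = Pi\<^sub>M {..<n} (\<lambda>_. lborel)"

abbreviation Rn :: "nat \<Rightarrow> (nat \<Rightarrow> real) set" where
  "Rn n \<equiv> space (lebesgue_Rn n)"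

text \<open>
  A law is log-concave if it has a density \<open>exp (- V)\<close> with \<open>V\<close> convex and possibly infinite.
  Zeros of the density are covered by \<open>0 powr a = 0\<close>.
\<close>

definition log_concave_fun :: "nat \<Rightarrow> ((nat \<Rightarrow> real) \<Rightarrow> real) \<Rightarrow> bool" where
  "log_concave_fun n g \<longleftrightarrow>
     (\<forall>x\<in>Rn n. 0 \<le> g x) \<and>
     (\<forall>x\<in>Rn n. \<forall>y\<in>Rn n. \<forall>t\<in>{0<..<1}.
        g x powr (1 - t) * g y powr t \<le> g (\<lambda>i\<in>{..<n}. (1 - t) * x i + t * y i))"

definition log_concave_law :: "nat \<Rightarrow> (nat \<Rightarrow> real) measure \<Rightarrow> bool" where
  "log_concave_law n \<mu> \<longleftrightarrow>
     prob_space \<mu> \<and>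
     (\<exists>g\<in>borel_measurable (lebesgue_Rn n).
        log_concave_fun n g \<and> \<mu> = density (lebesgue_Rn n) (\<lambda>x. ennreal (g x)))"

definition centered_law :: "nat \<Rightarrow> (nat \<Rightarrow> real) measure \<Rightarrow> bool" where
  "centered_law n \<mu> \<longleftrightarrow> (\<forall>i<n. integrable \<mu> (\<lambda>x. x i) \<and> (\<integral>x. x i \<partial>\<mu>) = 0)"

definition isotropic_law :: "nat \<Rightarrow> (nat \<Rightarrow> real) measure \<Rightarrow> bool" where
  "isotropic_law n \<mu> \<longleftrightarrow>
     centered_law n \<mu> \<and>
     (\<forall>i<n. \<forall>j<n.
        integrable \<mu> (\<lambda>x. (x i - (\<integral>y. y i \<partial>\<mu>)) * (x j - (\<integral>y. y j \<partial>\<mu>))) \<and>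
        (\<integral>x. (x i - (\<integral>y. y i \<partial>\<mu>)) * (x j - (\<integral>y. y j \<partial>\<mu>)) \<partial>\<mu>) = (if i = j then 1 else 0))"

definition locally_lipschitz_Rn :: "nat \<Rightarrow> ((nat \<Rightarrow> real) \<Rightarrow> real) \<Rightarrow> bool" where
  "locally_lipschitz_Rn n f \<longleftrightarrow>
     (\<forall>x\<in>Rn n. \<exists>r>0. \<exists>L. \<forall>y\<in>Rn n. \<forall>z\<in>Rn n.
        L2_set (\<lambda>i. y i - x i) {..<n} < r \<longrightarrow> L2_set (\<lambda>i. z i - x i) {..<n} < r \<longrightarrow>
        \<bar>f y - f z\<bar> \<le> L * L2_set (\<lambda>i. y i - z i) {..<n})"

text \<open>
  For locally Lipschitz \<open>f\<close> the partial derivatives exist outside a Lebesgue null set (Rademacher);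
  on that set \<open>deriv\<close> takes an unspecified value, which is irrelevant for laws with a density.
\<close>

definition gradient_Rn :: "nat \<Rightarrow> ((nat \<Rightarrow> real) \<Rightarrow> real) \<Rightarrow> (nat \<Rightarrow> real) \<Rightarrow> (nat \<Rightarrow> real)" where
  "gradient_Rn n f x = (\<lambda>i\<in>{..<n}. deriv (\<lambda>t. f (x(i := t))) (x i))"

definition max_directional_variance :: "nat \<Rightarrow> (nat \<Rightarrow> real) measure \<Rightarrow> ennreal" where
  "max_directional_variance n \<mu> =
     (SUP \<theta>\<in>{\<theta>\<in>Rn n. L2_set \<theta> {..<n} = 1}. \<integral>\<^sup>+x. ennreal ((\<Sum>i<n. x i * \<theta> i)\<^sup>2) \<partial>\<mu>)"

text \<open>
  The assertion only involves the law of the random vector, so it is quantified over laws.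
  The inequality is stated in \<open>[0, \<infinity>]\<close> because the energy of \<open>f\<close> may be infinite.
\<close>

definition KLS_conjecture :: bool where
  "KLS_conjecture \<longleftrightarrow>
     (\<exists>C::real. C > 0 \<and>
       (\<forall>n\<ge>1. \<forall>\<mu>. log_concave_law n \<mu> \<longrightarrow> centered_law n \<mu> \<longrightarrow>
         (\<forall>f. locally_lipschitz_Rn n f \<longrightarrow>
              integrable \<mu> f \<longrightarrow> integrable \<mu> (\<lambda>x. (f x)\<^sup>2) \<longrightarrow>
              ennreal (\<integral>x. (f x - (\<integral>y. f y \<partial>\<mu>))\<^sup>2 \<partial>\<mu>)
                \<le> ennreal C * max_directional_variance n \<mu> *
                  (\<integral>\<^sup>+x. ennreal ((L2_set (gradient_Rn n f x) {..<n})\<^sup>2) \<partial>\<mu>))))"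

definition log_prob :: "real \<Rightarrow> ereal" where
  "log_prob p = (if p = 0 then - \<infinity> else ereal (ln p))"

definition lower_semicontinuous :: "('b::topological_space \<Rightarrow> ereal) \<Rightarrow> bool" where
  "lower_semicontinuous I \<longleftrightarrow> (\<forall>x. \<forall>y < I x. \<forall>\<^sub>F z in nhds x. y < I z)"

definition rate_function :: "('b::topological_space \<Rightarrow> ereal) \<Rightarrow> bool" where
  "rate_function I \<longleftrightarrow>
     (\<forall>x. 0 \<le> I x) \<and> lower_semicontinuous I \<and> (\<forall>\<alpha>::real. compact {x. I x \<le> ereal \<alpha>})"

text \<open>
  Sequences are indexed by \<open>n \<ge> 1\<close>. The random vectors may live on different probability spaces.
\<close>

definition satisfies_LDP ::
  "(nat \<Rightarrow> 'a measure) \<Rightarrow> (nat \<Rightarrow> 'a \<Rightarrow> 'b::euclidean_space) \<Rightarrow> (nat \<Rightarrow> real) \<Rightarrow> ('b \<Rightarrow> ereal) \<Rightarrow> bool"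
  where
  "satisfies_LDP M X s I \<longleftrightarrow>
     (\<forall>n\<ge>1. prob_space (M n) \<and> X n \<in> borel_measurable (M n) \<and> 0 < s n) \<and>
     rate_function I \<and>
     (\<forall>A\<in>sets borel.
        (let p = (\<lambda>n. ereal (1 / s n) * log_prob (measure (M n) {\<omega>\<in>space (M n). X n \<omega> \<in> A}))
         in - (INF x\<in>interior A. I x) \<le> liminf p \<and>
            liminf p \<le> limsup p \<and>
            limsup p \<le> - (INF x\<in>closure A. I x)))"

definition singular_rate :: "real \<Rightarrow> ereal" where
  "singular_rate x = (if x = 1 then 0 else \<infinity>)"

end

theory Submission
  imports Defs
begin

text \<open>
  The KLS conjecture provides every isotropic log-concave law, in every dimension, with a Poincare
  inequality with one and the same constant. As Gromov and Milman observed, a Poincare inequality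
  forces exponential concentration of Lipschitz functions. Applied to the Euclidean norm it gives
  \<open>P (\<bar>\<parallel>\<xi>\<parallel> - sqrt k\<bar> > v) \<le> exp (A - c * v)\<close> with \<open>A\<close> and \<open>c\<close> independent of the dimension
  \<open>k\<close> (\<open>KLS_norm_concentration\<close>), that is, \<open>\<parallel>\<xi>\<parallel> / sqrt k\<close> leaves a \<open>\<delta>\<close>-neighbourhood of \<open>1\<close> with
  probability at most \<open>exp (A - c * \<delta> * sqrt k)\<close>.

  This is incompatible with the large deviations in question. At a speed below \<open>sqrt k\<close> such
  probabilities vanish on the scale of the LDP, so the rate function is infinite off \<open>1\<close>, and a
  rate function with infimum \<open>0\<close> is then singular. At speed comparable to \<open>sqrt k\<close> the bound with
  \<open>\<delta> = t - 1\<close> makes the infimum of the rate function over \<open>(t, \<infinity>)\<close> grow at least linearly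
  in \<open>t\<close>. In both cases it is the LDP lower bound on open sets that meets the concentration
  (\<open>LDP_open_lower_bound\<close>).

  The passage from Poincare to concentration tests the inequality with bounded functions rather
  than with exponentials. Let \<open>f\<close> rise from \<open>0\<close> on \<open>{g \<le> r}\<close> to \<open>1\<close> on \<open>{g \<ge> r + h}\<close>.
  If \<open>r\<close> is above a median, the variance of \<open>f\<close> is at least half of \<open>P (g \<ge> r + h)\<close>, whereas its
  energy is at most a multiple of \<open>P (r \<le> g < r + h) / h\<^sup>2\<close>; for \<open>h = sqrt (8 * C)\<close> this says that
  the tail halves over each step of length \<open>h\<close> (\<open>tail_halving\<close>). The profile of \<open>f\<close> is \<open>C\<^sup>1\<close> and the
  norm is replaced by \<open>sqrt (1 + \<parallel>x\<parallel>\<^sup>2)\<close>, so that all test functions are differentiable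
  everywhere and the energy can be computed pointwise from explicit partial derivatives.
\<close>

section \<open>A continuously differentiable ramp\<close>

text \<open>
  The \<open>C\<^sup>1\<close> quadratic spline that equals \<open>0\<close> up to \<open>0\<close>, \<open>2 * u\<^sup>2\<close> on \<open>[0, 1/2]\<close>,
  \<open>1 - 2 * (1 - u)\<^sup>2\<close> on \<open>[1/2, 1]\<close> and \<open>1\<close> from there on. Written with squared positive parts,
  it needs no case distinction at the knots when it is differentiated.
\<close>

definition ramp :: "real \<Rightarrow> real" where
  "ramp u = 2 * (max 0 u)\<^sup>2 - 4 * (max 0 (u - 1/2))\<^sup>2 + 2 * (max 0 (u - 1))\<^sup>2"

definition ramp_slope :: "real \<Rightarrow> real" where
  "ramp_slope u = 4 * max 0 u - 8 * max 0 (u - 1/2) + 4 * max 0 (u - 1)"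

lemma has_derivative_positive_part_squared:
  "((\<lambda>v. (max 0 v)\<^sup>2) has_real_derivative 2 * max 0 u) (at (u::real))"
proof (cases u "0::real" rule: linorder_cases)
  case less
  have "((\<lambda>v::real. 0) has_real_derivative 0) (at u)" by simp
  then have "((\<lambda>v. (max 0 v)\<^sup>2) has_real_derivative 0) (at u)"
    by (rule has_field_derivative_transform_within_open[where S = "{..<0}"]) (use less in auto)
  then show ?thesis using less by simp
next
  case greater
  have "((\<lambda>v::real. v\<^sup>2) has_real_derivative 2 * u) (at u)"
    by (auto intro!: derivative_eq_intros)
  then have "((\<lambda>v. (max 0 v)\<^sup>2) has_real_derivative 2 * u) (at u)"
    by (rule has_field_derivative_transform_within_open[where S = "{0<..}"]) (use greater in auto)
  then show ?thesis using greater by simp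
next
  case equal
  \<comment> \<open>At the kink of the positive part the difference quotient is dominated by \<open>\<bar>v\<bar>\<close>.\<close>
  have "((\<lambda>v::real. (max 0 v)\<^sup>2 / v) \<longlongrightarrow> 0) (at 0)"
  proof (rule tendsto_0_le[where f = "\<lambda>v. v" and K = 1])
    show "((\<lambda>v::real. v) \<longlongrightarrow> 0) (at 0)" by simp
    show "\<forall>\<^sub>F v::real in at 0. norm ((max 0 v)\<^sup>2 / v) \<le> norm v * 1"
      by (rule always_eventually) (auto simp: max_def power2_eq_square)
  qed
  then show ?thesis
    using equal by (simp add: has_field_derivative_iff)
qed

lemma has_derivative_ramp: "(ramp has_real_derivative ramp_slope u) (at u)"
proof -
  have shifted: "((\<lambda>v. (max 0 (v - c))\<^sup>2) has_real_derivative 2 * max 0 (u - c)) (at u)" for c :: real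
    using DERIV_shift[of "\<lambda>v. (max 0 v)\<^sup>2" "2 * max 0 (u - c)" u "- c"]
      has_derivative_positive_part_squared[of "u - c"] by simp
  have "((\<lambda>v. 2 * (max 0 v)\<^sup>2 - 4 * (max 0 (v - 1/2))\<^sup>2 + 2 * (max 0 (v - 1))\<^sup>2)
      has_real_derivative ramp_slope u) (at u)"
    unfolding ramp_slope_def
    by (rule derivative_eq_intros shifted has_derivative_positive_part_squared refl)+ simp
  then show ?thesis unfolding ramp_def[abs_def] .
qed

lemma ramp_eq_0: "u \<le> 0 \<Longrightarrow> ramp u = 0"
  by (simp add: ramp_def)

lemma ramp_eq_1: "1 \<le> u \<Longrightarrow> ramp u = 1"
  by (simp add: ramp_def power2_eq_square algebra_simps)

lemma ramp_slope_bound: "\<bar>ramp_slope u\<bar> \<le> 2"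
  by (auto simp: ramp_slope_def max_def)

lemma ramp_slope_outside: "u \<le> 0 \<or> 1 \<le> u \<Longrightarrow> ramp_slope u = 0"
  by (auto simp: ramp_slope_def max_def)

lemma ramp_Lipschitz: "\<bar>ramp u - ramp v\<bar> \<le> 2 * \<bar>u - v\<bar>"
  using field_differentiable_bound[of UNIV ramp ramp_slope 2 u v]
    has_derivative_ramp ramp_slope_bound by simp

text \<open>
  The bound serves to make functions composed with the ramp integrable; the constant comes from
  the Lipschitz bound between \<open>0\<close> and \<open>1\<close>.
\<close>
lemma ramp_bounded: "\<bar>ramp u\<bar> \<le> 2"
proof -
  have "\<bar>ramp (min u 1)\<bar> \<le> 2"
    using ramp_Lipschitz[of "min u 1" 0] ramp_eq_0[of "min u 1"] ramp_eq_0[of 0]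
    by (cases "u \<le> 0") (auto simp: min_def split: if_splits)
  then show ?thesis
    by (cases "u \<le> 1") (auto simp: ramp_eq_1)
qed

lemma ramp_measurable [measurable]: "ramp \<in> borel_measurable borel"
  unfolding ramp_def[abs_def] by measurable

section \<open>Exponential concentration from a Poincare inequality\<close>

text \<open>
  The gradient is carried along as explicit data. Existence of the partial derivatives at every
  point is what makes the unspecified values of \<open>deriv\<close> harmless.
\<close>
definition contraction_with_gradient ::
  "nat \<Rightarrow> ((nat \<Rightarrow> real) \<Rightarrow> real) \<Rightarrow> ((nat \<Rightarrow> real) \<Rightarrow> nat \<Rightarrow> real) \<Rightarrow> bool" where
  "contraction_with_gradient n g D \<longleftrightarrow>
     g \<in> borel_measurable (lebesgue_Rn n) \<and>
     (\<forall>x\<in>Rn n. \<forall>y\<in>Rn n. \<bar>g x - g y\<bar> \<le> L2_set (\<lambda>i. x i - y i) {..<n}) \<and>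
     (\<forall>x\<in>Rn n. \<forall>i<n. ((\<lambda>t. g (x(i := t))) has_real_derivative D x i) (at (x i))) \<and>
     (\<forall>x\<in>Rn n. (\<Sum>i<n. (D x i)\<^sup>2) \<le> 1)"

lemma contraction_with_gradient_uminus:
  assumes "contraction_with_gradient n g D"
  shows "contraction_with_gradient n (\<lambda>x. - g x) (\<lambda>x i. - D x i)"
  using assms unfolding contraction_with_gradient_def
  by (auto intro!: DERIV_minus) (metis abs_minus_commute)

lemma locally_lipschitz_RnI:
  assumes "\<And>x y. x \<in> Rn n \<Longrightarrow> y \<in> Rn n \<Longrightarrow> \<bar>f x - f y\<bar> \<le> L * L2_set (\<lambda>i. x i - y i) {..<n}"
  shows "locally_lipschitz_Rn n f"
  unfolding locally_lipschitz_Rn_def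
  by (intro ballI exI[of _ 1] conjI exI[of _ L]) (use assms in auto)

lemma L2_gradient_Rn_squared:
  assumes "\<And>i. i < n \<Longrightarrow> ((\<lambda>t. f (x(i := t))) has_real_derivative D i) (at (x i))"
  shows "(L2_set (gradient_Rn n f x) {..<n})\<^sup>2 = (\<Sum>i<n. (D i)\<^sup>2)"
proof -
  have "gradient_Rn n f x i = D i" if "i < n" for i
    using that assms[OF that] by (simp add: gradient_Rn_def DERIV_imp_deriv)
  then show ?thesis
    by (simp add: L2_set_def sum_nonneg)
qed

text \<open>
  The inequality has the form in which the KLS conjecture delivers it once the maximal directional
  variance has been bounded by \<open>1\<close>.
\<close>
locale poincare_law = prob_space \<mu> for \<mu> :: "(nat \<Rightarrow> real) measure" +
  fixes n :: nat and C :: real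
  assumes sets_law: "sets \<mu> = sets (lebesgue_Rn n)"
    and C_pos: "0 < C"
    and poincare: "\<And>f. locally_lipschitz_Rn n f \<Longrightarrow> integrable \<mu> f \<Longrightarrow> integrable \<mu> (\<lambda>x. (f x)\<^sup>2) \<Longrightarrow>
      ennreal (variance f) \<le>
        ennreal C * (\<integral>\<^sup>+x. ennreal ((L2_set (gradient_Rn n f x) {..<n})\<^sup>2) \<partial>\<mu>)"
begin

lemma space_law: "space \<mu> = Rn n"
  using sets_eq_imp_space_eq[OF sets_law] .

lemma variance_contraction_le:
  assumes g: "contraction_with_gradient n g D"
    and int: "integrable \<mu> g" "integrable \<mu> (\<lambda>x. (g x)\<^sup>2)"
  shows "variance g \<le> C"
proof -
  have "locally_lipschitz_Rn n g"
    by (rule locally_lipschitz_RnI[where L = 1])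
       (use g in \<open>auto simp: contraction_with_gradient_def\<close>)
  then have "ennreal (variance g) \<le>
      ennreal C * (\<integral>\<^sup>+x. ennreal ((L2_set (gradient_Rn n g x) {..<n})\<^sup>2) \<partial>\<mu>)"
    using poincare int by blast
  also have "(\<integral>\<^sup>+x. ennreal ((L2_set (gradient_Rn n g x) {..<n})\<^sup>2) \<partial>\<mu>) \<le> (\<integral>\<^sup>+x. 1 \<partial>\<mu>)"
  proof (rule nn_integral_mono)
    fix x assume "x \<in> space \<mu>"
    then have "(L2_set (gradient_Rn n g x) {..<n})\<^sup>2 \<le> 1"
      using g L2_gradient_Rn_squared[of n g x "D x"]
      by (auto simp: contraction_with_gradient_def space_law)
    then show "ennreal ((L2_set (gradient_Rn n g x) {..<n})\<^sup>2) \<le> 1"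
      using ennreal_leI by fastforce
  qed
  finally show ?thesis
    using C_pos by (simp add: emeasure_space_1 mult_left_mono)
qed

text \<open>
  If a random variable has mean \<open>m\<close>, the two level sets alone contribute
  \<open>m\<^sup>2 * P A + (1 - m)\<^sup>2 * P B\<close> to the variance. Whatever \<open>m\<close> is, this is at least
  \<open>P A * P B / (P A + P B)\<close>, and \<open>P A + P B \<le> 1\<close> because the sets are disjoint.
\<close>
lemma variance_two_level_sets:
  assumes f: "f \<in> borel_measurable \<mu>" "integrable \<mu> (\<lambda>x. (f x - expectation f)\<^sup>2)"
    and A: "A \<in> events" "\<And>x. x \<in> A \<Longrightarrow> f x = 0"
    and B: "B \<in> events" "\<And>x. x \<in> B \<Longrightarrow> f x = 1"
  shows "prob A * prob B \<le> variance f"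
proof -
  define m where "m = expectation f"
  have disj: "A \<inter> B = {}" using A(2) B(2) by fastforce
  have "prob A + prob B = prob (A \<union> B)"
    using A(1) B(1) disj by (simp add: finite_measure_Union)
  then have le1: "prob A + prob B \<le> 1" by simp
  have "m\<^sup>2 * prob A + (1 - m)\<^sup>2 * prob B
      = (\<integral>x. m\<^sup>2 * indicator A x + (1 - m)\<^sup>2 * indicator B x \<partial>\<mu>)"
    using A(1) B(1) by (subst Bochner_Integration.integral_add) (auto simp: emeasure_eq_measure)
  also have "\<dots> \<le> (\<integral>x. (f x - m)\<^sup>2 \<partial>\<mu>)"
  proof (rule integral_mono)
    show "integrable \<mu> (\<lambda>x. m\<^sup>2 * indicator A x + (1 - m)\<^sup>2 * indicator B x)"
      using A(1) B(1) by (auto simp: emeasure_eq_measure)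
    show "integrable \<mu> (\<lambda>x. (f x - m)\<^sup>2)" using f(2) by (simp add: m_def)
    show "m\<^sup>2 * indicator A x + (1 - m)\<^sup>2 * indicator B x \<le> (f x - m)\<^sup>2" for x
      using A(2)[of x] B(2)[of x] disj by (auto simp: indicator_def split: if_splits)
  qed
  finally have lower: "m\<^sup>2 * prob A + (1 - m)\<^sup>2 * prob B \<le> variance f" by (simp add: m_def)
  have "prob A * prob B \<le> (prob A + prob B) * (m\<^sup>2 * prob A + (1 - m)\<^sup>2 * prob B)"
  proof -
    have "(prob A + prob B) * (m\<^sup>2 * prob A + (1 - m)\<^sup>2 * prob B) - prob A * prob B
        = (m * prob A - (1 - m) * prob B)\<^sup>2"
      by (simp add: power2_eq_square algebra_simps)
    then show ?thesis using zero_le_power2[of "m * prob A - (1 - m) * prob B"] by linarith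
  qed
  also have "\<dots> \<le> 1 * (m\<^sup>2 * prob A + (1 - m)\<^sup>2 * prob B)"
    by (rule mult_right_mono[OF le1]) simp
  finally show ?thesis using lower by simp
qed

text \<open>
  Test the Poincare inequality with the ramp in \<open>g\<close> between the levels \<open>r\<close> and \<open>r + h\<close>.
  Its gradient lives on the layer \<open>{r \<le> g < r + h}\<close> and is at most \<open>2 / h\<close> there. Writing
  \<open>q\<close> and \<open>p\<close> for the tails at \<open>r + h\<close> and \<open>r\<close>, the inequality therefore reads
  \<open>q / 2 \<le> 4 * C / h\<^sup>2 * (p - q)\<close>. The choice \<open>h\<^sup>2 = 8 * C\<close> makes the factor on the right \<open>1/2\<close>,
  whence \<open>q \<le> p - q\<close>.
\<close>
lemma tail_halving:
  assumes g: "contraction_with_gradient n g D"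
    and half: "1/2 \<le> prob {x\<in>space \<mu>. g x \<le> r}"
  shows "prob {x\<in>space \<mu>. r + sqrt (8 * C) \<le> g x} \<le> prob {x\<in>space \<mu>. r \<le> g x} / 2"
proof -
  define h where "h = sqrt (8 * C)"
  have h: "0 < h" "h\<^sup>2 = 8 * C" using C_pos by (auto simp: h_def)
  have g_meas [measurable]: "g \<in> borel_measurable \<mu>"
    using g sets_law measurable_cong_sets by (force simp: contraction_with_gradient_def)
  define f where "f x = ramp ((g x - r) / h)" for x
  define Z where "Z = {x\<in>space \<mu>. g x \<le> r}"
  define U where "U = {x\<in>space \<mu>. r \<le> g x}"
  define T where "T = {x\<in>space \<mu>. r + h \<le> g x}"
  have [measurable]: "Z \<in> events" "U \<in> events" "T \<in> events"
    unfolding Z_def U_def T_def by measurable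
  have f_meas [measurable]: "f \<in> borel_measurable \<mu>"
    unfolding f_def[abs_def] by measurable
  have f_int: "integrable \<mu> f"
    by (rule integrable_const_bound[where B = 2]) (auto simp: f_def ramp_bounded)
  have f2_int: "integrable \<mu> (\<lambda>x. (f x)\<^sup>2)"
    by (rule integrable_const_bound[where B = 4])
       (auto simp: f_def intro!: AE_I2 power2_le_iff_abs_le[THEN iffD2, of 2, simplified] ramp_bounded)
  have var_int: "integrable \<mu> (\<lambda>x. (f x - expectation f)\<^sup>2)"
    using f_int f2_int by (auto simp: power2_diff)
  have "locally_lipschitz_Rn n f"
  proof (rule locally_lipschitz_RnI[where L = "2 / h"])
    fix x y assume xy: "x \<in> Rn n" "y \<in> Rn n"
    have "\<bar>f x - f y\<bar> \<le> 2 * \<bar>(g x - r) / h - (g y - r) / h\<bar>"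
      unfolding f_def by (rule ramp_Lipschitz)
    also have "\<dots> = 2 / h * \<bar>g x - g y\<bar>"
      using h by (simp add: abs_divide flip: diff_divide_distrib)
    also have "\<dots> \<le> 2 / h * L2_set (\<lambda>i. x i - y i) {..<n}"
      by (rule mult_left_mono) (use g xy h in \<open>auto simp: contraction_with_gradient_def\<close>)
    finally show "\<bar>f x - f y\<bar> \<le> 2 / h * L2_set (\<lambda>i. x i - y i) {..<n}" .
  qed
  from poincare[OF this f_int f2_int]
  have "ennreal (variance f) \<le>
      ennreal C * (\<integral>\<^sup>+x. ennreal ((L2_set (gradient_Rn n f x) {..<n})\<^sup>2) \<partial>\<mu>)" .
  also have "(\<integral>\<^sup>+x. ennreal ((L2_set (gradient_Rn n f x) {..<n})\<^sup>2) \<partial>\<mu>)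
      \<le> (\<integral>\<^sup>+x. ennreal (4 / h\<^sup>2) * indicator (U - T) x \<partial>\<mu>)"
  proof (rule nn_integral_mono)
    fix x assume x: "x \<in> space \<mu>"
    define c where "c = ramp_slope ((g x - r) / h) / h"
    have "((\<lambda>t. f (x(i := t))) has_real_derivative c * D x i) (at (x i))" if "i < n" for i
    proof -
      have "((\<lambda>t. (g (x(i := t)) - r) / h) has_real_derivative D x i / h) (at (x i))"
        by (rule derivative_eq_intros refl
            | use g x that h in \<open>force simp: contraction_with_gradient_def space_law\<close>)+
      from DERIV_chain2[OF has_derivative_ramp this] show ?thesis
        by (simp add: f_def c_def)
    qed
    then have "(L2_set (gradient_Rn n f x) {..<n})\<^sup>2 = (\<Sum>i<n. (c * D x i)\<^sup>2)"
      by (rule L2_gradient_Rn_squared)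
    also have "\<dots> = c\<^sup>2 * (\<Sum>i<n. (D x i)\<^sup>2)"
      by (simp add: power_mult_distrib sum_distrib_left)
    also have "\<dots> \<le> c\<^sup>2 * 1"
      by (rule mult_left_mono) (use g x in \<open>auto simp: contraction_with_gradient_def space_law\<close>)
    finally have grad: "(L2_set (gradient_Rn n f x) {..<n})\<^sup>2 \<le> c\<^sup>2" by simp
    show "ennreal ((L2_set (gradient_Rn n f x) {..<n})\<^sup>2) \<le> ennreal (4 / h\<^sup>2) * indicator (U - T) x"
    proof (cases "x \<in> U - T")
      case True
      have "(ramp_slope ((g x - r) / h))\<^sup>2 \<le> 2\<^sup>2"
        using ramp_slope_bound abs_le_square_iff by fastforce
      then have "c\<^sup>2 \<le> 4 / h\<^sup>2"
        by (simp add: c_def power_divide divide_right_mono)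
      then show ?thesis using True grad by (auto intro!: ennreal_leI)
    next
      case False
      then have "g x \<le> r \<or> r + h \<le> g x" using x by (auto simp: U_def T_def)
      then have "c = 0"
        using h by (auto simp: c_def field_simps intro!: ramp_slope_outside)
      then show ?thesis using False grad by simp
    qed
  qed
  also have "\<dots> = ennreal (4 / h\<^sup>2 * prob (U - T))"
    by (simp only: nn_integral_cmult_indicator emeasure_eq_measure ennreal_mult[symmetric]
        \<open>U \<in> events\<close> \<open>T \<in> events\<close> sets.Diff zero_le_divide_iff) (simp add: ennreal_mult[symmetric])
  also have "ennreal C * \<dots> = ennreal (prob (U - T) / 2)"
    using C_pos h by (simp add: ennreal_mult[symmetric])
  finally have "variance f \<le> prob (U - T) / 2"
    by (simp add: mult_left_mono)
  moreover have "prob (U - T) = prob U - prob T"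
    by (rule finite_measure_Diff) (use h in \<open>auto simp: U_def T_def\<close>)
  moreover have "prob Z * prob T \<le> variance f"
  proof (rule variance_two_level_sets)
    show "f x = 0" if "x \<in> Z" for x
      using that h by (auto simp: Z_def f_def divide_le_0_iff intro!: ramp_eq_0)
    show "f x = 1" if "x \<in> T" for x
      using that h by (auto simp: T_def f_def field_simps intro!: ramp_eq_1)
  qed (use var_int in auto)
  moreover have "1/2 * prob T \<le> prob Z * prob T"
    by (rule mult_right_mono) (use half in \<open>auto simp: Z_def\<close>)
  ultimately show ?thesis
    by (simp add: U_def T_def h_def)
qed

lemma tail_geometric:
  assumes g: "contraction_with_gradient n g D"
    and half: "1/2 \<le> prob {x\<in>space \<mu>. g x \<le> r}"
  shows "prob {x\<in>space \<mu>. r + real j * sqrt (8 * C) \<le> g x} \<le> (1/2) ^ j"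
proof (induction j)
  case 0
  show ?case by simp
next
  case (Suc j)
  let ?r = "r + real j * sqrt (8 * C)"
  have [measurable]: "g \<in> borel_measurable \<mu>"
    using g sets_law measurable_cong_sets by (force simp: contraction_with_gradient_def)
  have "r \<le> ?r" using C_pos by simp
  then have "prob {x\<in>space \<mu>. g x \<le> r} \<le> prob {x\<in>space \<mu>. g x \<le> ?r}"
    by (intro finite_measure_mono) auto
  with half have "1/2 \<le> prob {x\<in>space \<mu>. g x \<le> ?r}" by linarith
  from tail_halving[OF g this] Suc.IH show ?case
    by (simp add: algebra_simps)
qed

text \<open>
  Chebyshev's inequality and the variance bound \<open>C\<close> place a median at most \<open>h / 2\<close> above the mean,
  where \<open>h = sqrt (8 * C)\<close>; from there on the tail halves over every step of length \<open>h\<close>. The factor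
  \<open>4\<close> pays for the initial half step and for rounding the number of steps down, which together cost
  fewer than two halvings, and it makes the bound trivial for \<open>u < h / 2\<close>.
\<close>
theorem exponential_concentration:
  assumes g: "contraction_with_gradient n g D"
    and int: "integrable \<mu> g" "integrable \<mu> (\<lambda>x. (g x)\<^sup>2)"
  shows "prob {x\<in>space \<mu>. expectation g + u \<le> g x} \<le> 4 * 2 powr (- u / sqrt (8 * C))"
proof -
  have [measurable]: "g \<in> borel_measurable \<mu>"
    using g sets_law measurable_cong_sets by (force simp: contraction_with_gradient_def)
  define h where "h = sqrt (8 * C)"
  have h: "0 < h" "h\<^sup>2 = 8 * C" using C_pos by (auto simp: h_def)
  define r where "r = expectation g + h / 2"
  have "prob {x\<in>space \<mu>. h / 2 \<le> \<bar>g x - expectation g\<bar>} \<le> variance g / (h / 2)\<^sup>2"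
    by (rule Chebyshev_inequality) (use int h in auto)
  also have "\<dots> \<le> C / (h / 2)\<^sup>2"
    by (rule divide_right_mono[OF variance_contraction_le[OF g int]]) simp
  also have "\<dots> = 1/2" using C_pos h by (simp add: power_divide)
  finally have cheb: "prob {x\<in>space \<mu>. h / 2 \<le> \<bar>g x - expectation g\<bar>} \<le> 1/2" .
  have "1 = prob (space \<mu>)" by (simp add: prob_space)
  also have "\<dots> \<le> prob ({x\<in>space \<mu>. g x \<le> r} \<union> {x\<in>space \<mu>. h / 2 \<le> \<bar>g x - expectation g\<bar>})"
    by (rule finite_measure_mono) (auto simp: r_def field_simps abs_if split: if_splits)
  also have "\<dots> \<le> prob {x\<in>space \<mu>. g x \<le> r} + prob {x\<in>space \<mu>. h / 2 \<le> \<bar>g x - expectation g\<bar>}"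
    by (rule measure_Un_le) auto
  finally have half: "1/2 \<le> prob {x\<in>space \<mu>. g x \<le> r}" using cheb by linarith
  define j where "j = nat \<lfloor>u / h - 1/2\<rfloor>"
  show ?thesis
  proof (cases "u / h < 1/2")
    case True
    have "prob {x\<in>space \<mu>. expectation g + u \<le> g x} \<le> 1" by simp
    also have "1 \<le> (4::real) * 2 powr (- 1)" by (simp add: powr_minus)
    also have "\<dots> \<le> 4 * 2 powr (- u / h)"
    proof -
      have "- 1 \<le> - u / h" using True unfolding minus_divide_left[symmetric] by linarith
      then show ?thesis by (intro mult_left_mono powr_mono) auto
    qed
    finally show ?thesis by (simp add: h_def)
  next
    case False
    then have j: "real j \<le> u / h - 1/2" "u / h - 1/2 < real j + 1"
      unfolding j_def by linarith+
    have "r + real j * h \<le> expectation g + u"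
      using mult_right_mono[OF j(1), of h] h by (simp add: r_def algebra_simps)
    then have "prob {x\<in>space \<mu>. expectation g + u \<le> g x} \<le> prob {x\<in>space \<mu>. r + real j * h \<le> g x}"
      by (intro finite_measure_mono) auto
    also have "\<dots> \<le> (1/2) ^ j" using tail_geometric[OF g half] by (simp add: h_def)
    also have "\<dots> = 2 powr (- real j)" by (simp add: powr_minus powr_realpow power_divide field_simps)
    also have "\<dots> \<le> 2 powr (2 + - u / h)" using j(2) by (intro powr_mono) auto
    also have "\<dots> = 4 * 2 powr (- u / h)" by (subst powr_add) simp
    finally show ?thesis by (simp add: h_def)
  qed
qed

end


section \<open>Concentration of the norm under isotropic laws\<close>

text \<open>The shift by \<open>1\<close> removes the singularity of the norm at the origin.\<close>
definition smooth_norm :: "nat \<Rightarrow> (nat \<Rightarrow> real) \<Rightarrow> real" where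
  "smooth_norm n x = sqrt (1 + (L2_set x {..<n})\<^sup>2)"

lemma smooth_norm_squared: "(smooth_norm n x)\<^sup>2 = 1 + (\<Sum>i<n. (x i)\<^sup>2)"
  by (simp add: smooth_norm_def L2_set_def sum_nonneg add_nonneg_nonneg)

lemma smooth_norm_ge_1: "1 \<le> smooth_norm n x"
  by (simp add: smooth_norm_def)

lemma smooth_norm_bounds: "L2_set x {..<n} \<le> smooth_norm n x" "smooth_norm n x \<le> L2_set x {..<n} + 1"
proof -
  show "L2_set x {..<n} \<le> smooth_norm n x"
    unfolding smooth_norm_def by (rule real_le_rsqrt) simp
  show "smooth_norm n x \<le> L2_set x {..<n} + 1"
    unfolding smooth_norm_def
    by (rule real_le_lsqrt) (auto simp: power2_sum L2_set_nonneg)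
qed

lemma measurable_coordinate_Rn [measurable]:
  "i < n \<Longrightarrow> (\<lambda>x. x i) \<in> borel_measurable (lebesgue_Rn n)"
  unfolding lebesgue_Rn_def using measurable_component_singleton[of i "{..<n}" "\<lambda>_. lborel"] by simp

lemma measurable_L2_set_Rn [measurable]:
  "(\<lambda>x. L2_set x {..<n}) \<in> borel_measurable (lebesgue_Rn n)"
  unfolding L2_set_def by measurable

text \<open>This is the triangle inequality for the plane vectors \<open>(1, a)\<close> and \<open>(1, b)\<close>.\<close>
lemma sqrt_one_plus_square_diff_le:
  "\<bar>sqrt (1 + a\<^sup>2) - sqrt (1 + b\<^sup>2)\<bar> \<le> \<bar>a - b\<bar>" for a b :: real
  using norm_triangle_ineq3[of "Complex 1 a" "Complex 1 b"]
  by (simp add: cmod_def)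

lemma L2_set_diff_le: "\<bar>L2_set x A - L2_set y A\<bar> \<le> L2_set (\<lambda>i. x i - y i) A"
proof -
  have "L2_set x A \<le> L2_set (\<lambda>i. x i - y i) A + L2_set y A"
    using L2_set_triangle_ineq[of "\<lambda>i. x i - y i" y A] by simp
  moreover have "L2_set y A \<le> L2_set (\<lambda>i. y i - x i) A + L2_set x A"
    using L2_set_triangle_ineq[of "\<lambda>i. y i - x i" x A] by simp
  moreover have "L2_set (\<lambda>i. y i - x i) A = L2_set (\<lambda>i. x i - y i) A"
    by (simp add: L2_set_def power2_commute)
  ultimately show ?thesis by linarith
qed

lemma contraction_smooth_norm:
  "contraction_with_gradient n (smooth_norm n) (\<lambda>x i. x i / smooth_norm n x)"
  unfolding contraction_with_gradient_def
proof (intro conjI ballI allI impI)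
  show "smooth_norm n \<in> borel_measurable (lebesgue_Rn n)"
    unfolding smooth_norm_def[abs_def] by measurable
next
  fix x y :: "nat \<Rightarrow> real"
  show "\<bar>smooth_norm n x - smooth_norm n y\<bar> \<le> L2_set (\<lambda>i. x i - y i) {..<n}"
    unfolding smooth_norm_def
    using sqrt_one_plus_square_diff_le L2_set_diff_le by (rule order_trans)
next
  fix x :: "nat \<Rightarrow> real" and i assume i: "i < n"
  \<comment> \<open>Along the \<open>i\<close>-th coordinate line the function is \<open>sqrt (c + t\<^sup>2)\<close> with a fixed \<open>c > 0\<close>.\<close>
  define c where "c = 1 + (\<Sum>j\<in>{..<n} - {i}. (x j)\<^sup>2)"
  have c: "0 < c" unfolding c_def by (simp add: add_pos_nonneg sum_nonneg)
  have eq: "smooth_norm n (x(i := t)) = sqrt (c + t\<^sup>2)" for t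
  proof -
    have "(\<Sum>j<n. ((x(i := t)) j)\<^sup>2) = t\<^sup>2 + (\<Sum>j\<in>{..<n} - {i}. ((x(i := t)) j)\<^sup>2)"
      using i by (subst sum.remove[of _ i]) auto
    also have "(\<Sum>j\<in>{..<n} - {i}. ((x(i := t)) j)\<^sup>2) = (\<Sum>j\<in>{..<n} - {i}. (x j)\<^sup>2)"
      by (rule sum.cong) auto
    finally show ?thesis
      by (simp add: smooth_norm_def L2_set_def sum_nonneg c_def algebra_simps)
  qed
  have at: "smooth_norm n x = sqrt (c + (x i)\<^sup>2)" using eq[of "x i"] by simp
  have "((\<lambda>t. sqrt (c + t\<^sup>2)) has_real_derivative x i / sqrt (c + (x i)\<^sup>2)) (at (x i))"
    using add_pos_nonneg[OF c zero_le_power2[of "x i"]]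
    by (auto intro!: derivative_eq_intros simp: field_simps)
  then show "((\<lambda>t. smooth_norm n (x(i := t))) has_real_derivative x i / smooth_norm n x) (at (x i))"
    by (simp add: eq at)
next
  fix x :: "nat \<Rightarrow> real"
  have "(\<Sum>i<n. (x i / smooth_norm n x)\<^sup>2) = (\<Sum>i<n. (x i)\<^sup>2) / (smooth_norm n x)\<^sup>2"
    by (simp add: power_divide sum_divide_distrib)
  also have "\<dots> \<le> 1"
    unfolding smooth_norm_squared by (simp add: divide_le_eq_1 add_pos_nonneg sum_nonneg)
  finally show "(\<Sum>i<n. (x i / smooth_norm n x)\<^sup>2) \<le> 1" .
qed

lemma isotropic_law_second_moments:
  assumes "isotropic_law n \<mu>" "i < n" "j < n"
  shows "integrable \<mu> (\<lambda>x. x i * x j)" "(\<integral>x. x i * x j \<partial>\<mu>) = (if i = j then 1 else 0)"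
  using assms unfolding isotropic_law_def centered_law_def by auto

lemma max_directional_variance_isotropic_le:
  assumes iso: "isotropic_law n \<mu>"
  shows "max_directional_variance n \<mu> \<le> 1"
  unfolding max_directional_variance_def
proof (rule SUP_least)
  fix \<theta> :: "nat \<Rightarrow> real" assume "\<theta> \<in> {\<theta> \<in> Rn n. L2_set \<theta> {..<n} = 1}"
  then have unit: "(\<Sum>i<n. (\<theta> i)\<^sup>2) = 1"
    by (simp add: L2_set_def)
  note mom = isotropic_law_second_moments[OF iso]
  have term_int: "integrable \<mu> (\<lambda>x. \<theta> i * \<theta> j * (x i * x j))" if "i < n" "j < n" for i j
    using mom(1)[OF that] by (rule integrable_mult_right)
  have expand: "(\<Sum>i<n. x i * \<theta> i)\<^sup>2 = (\<Sum>i<n. \<Sum>j<n. \<theta> i * \<theta> j * (x i * x j))" for x :: "nat \<Rightarrow> real"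
    by (simp add: power2_eq_square sum_product mult_ac)
  have "(\<integral>\<^sup>+x. ennreal ((\<Sum>i<n. x i * \<theta> i)\<^sup>2) \<partial>\<mu>) = ennreal (\<integral>x. (\<Sum>i<n. x i * \<theta> i)\<^sup>2 \<partial>\<mu>)"
  proof (rule nn_integral_eq_integral)
    show "integrable \<mu> (\<lambda>x. (\<Sum>i<n. x i * \<theta> i)\<^sup>2)"
      unfolding expand by (intro Bochner_Integration.integrable_sum term_int) auto
  qed simp
  also have "(\<integral>x. (\<Sum>i<n. x i * \<theta> i)\<^sup>2 \<partial>\<mu>)
      = (\<Sum>i<n. \<Sum>j<n. \<theta> i * \<theta> j * (\<integral>x. x i * x j \<partial>\<mu>))"
  proof -
    have "(\<integral>x. (\<Sum>i<n. x i * \<theta> i)\<^sup>2 \<partial>\<mu>) = (\<Sum>i<n. \<integral>x. (\<Sum>j<n. \<theta> i * \<theta> j * (x i * x j)) \<partial>\<mu>)"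
      unfolding expand
      by (intro Bochner_Integration.integral_sum Bochner_Integration.integrable_sum term_int) auto
    also have "\<dots> = (\<Sum>i<n. \<Sum>j<n. \<integral>x. \<theta> i * \<theta> j * (x i * x j) \<partial>\<mu>)"
      by (intro sum.cong refl Bochner_Integration.integral_sum term_int) auto
    finally show ?thesis by simp
  qed
  also have "\<dots> = (\<Sum>i<n. \<Sum>j<n. if i = j then (\<theta> i)\<^sup>2 else 0)"
    by (intro sum.cong refl) (auto simp: mom power2_eq_square)
  also have "\<dots> = 1" using unit by simp
  finally show "(\<integral>\<^sup>+x. ennreal ((\<Sum>i<n. x i * \<theta> i)\<^sup>2) \<partial>\<mu>) \<le> 1" by simp
qed

context poincare_law
begin

text \<open>
  Concentration holds around the mean \<open>a\<close> of the smooth norm \<open>N\<close>, so \<open>a\<close> has to be compared with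
  \<open>sqrt n\<close>. Isotropy gives \<open>E (N\<^sup>2) = n + 1\<close>, and the variance of \<open>N\<close> lies between \<open>0\<close> and \<open>C\<close>,
  so \<open>n + 1 - C \<le> a\<^sup>2 \<le> n + 1\<close>; this keeps \<open>a\<close> within \<open>C + 1\<close> of \<open>sqrt n\<close>. Replacing \<open>N\<close> by the
  norm costs another \<open>1\<close>. The two tails come from \<open>N\<close> and \<open>- N\<close>.
\<close>
lemma norm_concentration:
  assumes iso: "isotropic_law n \<mu>" and n: "1 \<le> n"
  shows "prob {x\<in>space \<mu>. v < \<bar>L2_set x {..<n} - sqrt (real n)\<bar>}
    \<le> 8 * 2 powr ((C + 2 - v) / sqrt (8 * C))"
proof -
  let ?g = "smooth_norm n"
  note mom = isotropic_law_second_moments[OF iso]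
  have [measurable]: "?g \<in> borel_measurable \<mu>" "(\<lambda>x. L2_set x {..<n}) \<in> borel_measurable \<mu>"
    using contraction_smooth_norm[of n] measurable_L2_set_Rn sets_law measurable_cong_sets
    by (force simp: contraction_with_gradient_def)+
  have g2_int: "integrable \<mu> (\<lambda>x. (?g x)\<^sup>2)"
    unfolding smooth_norm_squared unfolding power2_eq_square
    by (intro Bochner_Integration.integrable_add Bochner_Integration.integrable_sum) (auto intro: mom)
  have g_int: "integrable \<mu> ?g"
  proof (rule Bochner_Integration.integrable_bound[OF g2_int])
    show "AE x in \<mu>. norm (?g x) \<le> norm ((?g x)\<^sup>2)"
    proof (rule AE_I2)
      fix x show "norm (?g x) \<le> norm ((?g x)\<^sup>2)"
        using smooth_norm_ge_1[of n x] mult_left_mono[of 1 "?g x" "?g x"]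
        by (simp add: power2_eq_square)
    qed
  qed auto
  have second: "expectation (\<lambda>x. (?g x)\<^sup>2) = 1 + real n"
  proof -
    have "expectation (\<lambda>x. (?g x)\<^sup>2) = 1 + (\<Sum>i<n. expectation (\<lambda>x. x i * x i))"
      unfolding smooth_norm_squared unfolding power2_eq_square
      by (subst Bochner_Integration.integral_add)
         (auto intro!: Bochner_Integration.integrable_sum mom Bochner_Integration.integral_sum
           simp: prob_space)
    then show ?thesis by (simp add: mom)
  qed
  define a where "a = expectation ?g"
  have a_pos: "1 \<le> a"
    unfolding a_def using smooth_norm_ge_1 by (intro integral_ge_const g_int) auto
  have var: "variance ?g = 1 + real n - a\<^sup>2"
    using variance_eq[OF g_int g2_int] second by (simp add: a_def)
  have var_le: "1 + real n - a\<^sup>2 \<le> C"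
    using variance_contraction_le[OF contraction_smooth_norm g_int g2_int] var by simp
  have var_ge: "a\<^sup>2 \<le> 1 + real n"
    using var variance_positive[of ?g] by simp
  have sqrt_n: "1 \<le> sqrt (real n)" "(sqrt (real n))\<^sup>2 = real n" using n by auto
  have "a \<le> sqrt (real n) + 1"
  proof (rule power2_le_imp_le)
    show "a\<^sup>2 \<le> (sqrt (real n) + 1)\<^sup>2"
      using var_ge sqrt_n unfolding power2_sum one_power2 mult_1_right by linarith
  qed simp
  moreover have "sqrt (real n) \<le> a + C"
  proof (rule power2_le_imp_le)
    \<comment> \<open>Since \<open>a \<ge> 1\<close>, the cross term of \<open>(a + C)\<^sup>2\<close> absorbs the defect \<open>C\<close> of \<open>a\<^sup>2\<close>.\<close>
    have "1 * C \<le> a * C" using a_pos C_pos by (intro mult_right_mono) auto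
    moreover have "0 \<le> C\<^sup>2" "0 \<le> a * C" using C_pos a_pos by auto
    ultimately show "(sqrt (real n))\<^sup>2 \<le> (a + C)\<^sup>2"
      using var_le sqrt_n unfolding power2_sum mult.assoc by linarith
  qed (use a_pos C_pos in auto)
  ultimately have centre: "\<bar>a - sqrt (real n)\<bar> \<le> C + 1" using C_pos by linarith
  define u where "u = v - (C + 2)"
  have "{x\<in>space \<mu>. v < \<bar>L2_set x {..<n} - sqrt (real n)\<bar>}
      \<subseteq> {x\<in>space \<mu>. a + u \<le> ?g x} \<union> {x\<in>space \<mu>. - a + u \<le> - ?g x}"
  proof
    fix x assume "x \<in> {x\<in>space \<mu>. v < \<bar>L2_set x {..<n} - sqrt (real n)\<bar>}"
    then show "x \<in> {x\<in>space \<mu>. a + u \<le> ?g x} \<union> {x\<in>space \<mu>. - a + u \<le> - ?g x}"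
      using smooth_norm_bounds[where x = x and n = n] centre by (simp add: u_def) linarith
  qed
  then have "prob {x\<in>space \<mu>. v < \<bar>L2_set x {..<n} - sqrt (real n)\<bar>}
      \<le> prob ({x\<in>space \<mu>. a + u \<le> ?g x} \<union> {x\<in>space \<mu>. - a + u \<le> - ?g x})"
    by (rule finite_measure_mono) measurable
  also have "\<dots> \<le> prob {x\<in>space \<mu>. a + u \<le> ?g x} + prob {x\<in>space \<mu>. - a + u \<le> - ?g x}"
    by (rule measure_Un_le) measurable
  also have "\<dots> \<le> 4 * 2 powr (- u / sqrt (8 * C)) + 4 * 2 powr (- u / sqrt (8 * C))"
    using exponential_concentration[OF contraction_smooth_norm g_int g2_int, of u]
      exponential_concentration[OF contraction_with_gradient_uminus[OF contraction_smooth_norm], of u]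
      g_int g2_int
    by (intro add_mono) (simp_all add: a_def)
  finally show ?thesis by (simp add: u_def)
qed

end

text \<open>
  What matters is the order of the quantifiers: \<open>A\<close> and \<open>c\<close> depend on the KLS constant only, because
  isotropy normalises the maximal directional variance to at most \<open>1\<close> in every dimension.
\<close>
theorem KLS_norm_concentration:
  assumes KLS_conjecture
  obtains A c where "0 < A" "0 < c"
    "\<And>n \<mu> v. 1 \<le> n \<Longrightarrow> log_concave_law n \<mu> \<Longrightarrow> isotropic_law n \<mu> \<Longrightarrow>
      measure \<mu> {x\<in>space \<mu>. v < \<bar>L2_set x {..<n} - sqrt (real n)\<bar>} \<le> exp (A - c * v)"
proof -
  from assms obtain C where C: "0 < C" and KLS:
    "\<And>n \<mu> f. 1 \<le> n \<Longrightarrow> log_concave_law n \<mu> \<Longrightarrow> centered_law n \<mu> \<Longrightarrow> locally_lipschitz_Rn n f \<Longrightarrow>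
      integrable \<mu> f \<Longrightarrow> integrable \<mu> (\<lambda>x. (f x)\<^sup>2) \<Longrightarrow>
      ennreal (\<integral>x. (f x - (\<integral>y. f y \<partial>\<mu>))\<^sup>2 \<partial>\<mu>)
        \<le> ennreal C * max_directional_variance n \<mu> *
          (\<integral>\<^sup>+x. ennreal ((L2_set (gradient_Rn n f x) {..<n})\<^sup>2) \<partial>\<mu>)"
    unfolding KLS_conjecture_def by blast
  define c where "c = ln 2 / sqrt (8 * C)"
  define A where "A = ln 8 + c * (C + 2)"
  have c: "0 < c" unfolding c_def using C by simp
  have A: "0 < A" unfolding A_def using c C by (simp add: add_pos_pos)
  have "measure \<mu> {x\<in>space \<mu>. v < \<bar>L2_set x {..<n} - sqrt (real n)\<bar>} \<le> exp (A - c * v)"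
    if n: "1 \<le> n" and lc: "log_concave_law n \<mu>" and iso: "isotropic_law n \<mu>" for n \<mu> v
  proof -
    interpret prob_space \<mu> using lc by (simp add: log_concave_law_def)
    interpret poincare_law \<mu> n C
    proof
      show "sets \<mu> = sets (lebesgue_Rn n)"
        using lc by (auto simp: log_concave_law_def)
      fix f assume "locally_lipschitz_Rn n f" "integrable \<mu> f" "integrable \<mu> (\<lambda>x. (f x)\<^sup>2)"
      then have "ennreal (variance f) \<le> ennreal C * max_directional_variance n \<mu> *
          (\<integral>\<^sup>+x. ennreal ((L2_set (gradient_Rn n f x) {..<n})\<^sup>2) \<partial>\<mu>)"
        using KLS[OF n lc] iso by (simp add: isotropic_law_def)
      also have "\<dots> \<le> ennreal C * 1 * (\<integral>\<^sup>+x. ennreal ((L2_set (gradient_Rn n f x) {..<n})\<^sup>2) \<partial>\<mu>)"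
        by (intro mult_right_mono mult_left_mono max_directional_variance_isotropic_le[OF iso]) auto
      finally show "ennreal (variance f) \<le>
          ennreal C * (\<integral>\<^sup>+x. ennreal ((L2_set (gradient_Rn n f x) {..<n})\<^sup>2) \<partial>\<mu>)" by simp
    qed (rule C)
    have "8 * 2 powr ((C + 2 - v) / sqrt (8 * C)) = exp (A - c * v)"
    proof -
      have "A - c * v = ln 8 + (C + 2 - v) / sqrt (8 * C) * ln 2"
        by (simp add: A_def c_def diff_divide_distrib add_divide_distrib algebra_simps)
      then show ?thesis by (simp add: exp_add powr_def)
    qed
    then show ?thesis using norm_concentration[OF iso n, of v] by simp
  qed
  then show ?thesis using that A c by blast
qed

section \<open>Large deviations against concentration\<close>
lemma log_prob_le:
  assumes "0 \<le> p" "p \<le> exp b"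
  shows "log_prob p \<le> ereal b"
  using assms ln_mono[of p "exp b"] by (auto simp: log_prob_def)

text \<open>
  An upper bound on the probabilities of an open set turns, through the lower bound of the LDP,
  into a lower bound on the rate function over that set. The value \<open>l = \<infinity>\<close> is allowed and
  covers probabilities that decay faster than the speed.
\<close>
lemma LDP_open_lower_bound:
  assumes LDP: "satisfies_LDP M X s I" and "open A"
    and le: "\<forall>\<^sub>F n in sequentially. measure (M n) {\<omega>\<in>space (M n). X n \<omega> \<in> A} \<le> exp (b n)"
    and lim: "(\<lambda>n. ereal (b n / s n)) \<longlonglongrightarrow> - l"
  shows "l \<le> (INF x\<in>A. I x)"
proof -
  define p where "p n = ereal (1 / s n) * log_prob (measure (M n) {\<omega>\<in>space (M n). X n \<omega> \<in> A})" for n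
  have "\<forall>\<^sub>F n in sequentially. p n \<le> ereal (b n / s n)"
    using le eventually_ge_at_top[of 1]
  proof eventually_elim
    case (elim n)
    have "0 < s n" using LDP elim by (auto simp: satisfies_LDP_def)
    then have "p n \<le> ereal (1 / s n) * ereal (b n)"
      unfolding p_def by (intro ereal_mult_left_mono log_prob_le) (use elim in auto)
    then show ?case by simp
  qed
  then have "liminf p \<le> liminf (\<lambda>n. ereal (b n / s n))"
    by (rule Liminf_mono)
  also have "\<dots> = - l" using lim lim_imp_Liminf by force
  finally have "liminf p \<le> - l" .
  moreover have "- (INF x\<in>A. I x) \<le> liminf p"
    using LDP \<open>open A\<close> borel_open[OF \<open>open A\<close>]
    unfolding satisfies_LDP_def Let_def p_def[abs_def]
    by (elim conjE) (drule bspec[where x = A], auto simp: interior_open)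
  ultimately have "- (INF x\<in>A. I x) \<le> - l" by (rule order_trans[rotated])
  then show ?thesis by simp
qed

text \<open>Apply the upper bound of the LDP to the whole space, which has probability \<open>1\<close>.\<close>
lemma LDP_rate_inf:
  assumes LDP: "satisfies_LDP M X s I"
  shows "(INF x. I x) \<le> 0"
proof -
  define p where "p n = ereal (1 / s n) * log_prob (measure (M n) {\<omega>\<in>space (M n). X n \<omega> \<in> UNIV})" for n
  have "\<forall>\<^sub>F n in sequentially. p n = 0"
    using eventually_ge_at_top[of 1]
  proof eventually_elim
    case (elim n)
    then have "prob_space (M n)" using LDP by (auto simp: satisfies_LDP_def)
    then show ?case by (simp add: p_def log_prob_def prob_space.prob_space)
  qed
  then have "p \<longlonglongrightarrow> 0" by (rule tendsto_eventually)
  then have "limsup p = 0" by (intro lim_imp_Limsup) auto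
  moreover have "limsup p \<le> - (INF x\<in>closure UNIV. I x)"
    using LDP unfolding satisfies_LDP_def Let_def p_def[abs_def]
    by (elim conjE) (drule bspec[where x = UNIV], auto)
  ultimately show ?thesis by simp
qed

theorem theorem1:
  fixes k :: "nat \<Rightarrow> nat"
    and M :: "nat \<Rightarrow> 'a measure"
    and \<xi> :: "nat \<Rightarrow> 'a \<Rightarrow> (nat \<Rightarrow> real)"
    and s :: "nat \<Rightarrow> real"
    and I :: "real \<Rightarrow> ereal"
  assumes k_bounds: "\<And>n. n \<ge> 1 \<Longrightarrow> 1 \<le> k n \<and> k n \<le> n"
    and k_omega: "(\<lambda>n. real (k n)) \<in> \<omega>(\<lambda>_. 1)"
    and prob: "\<And>n. n \<ge> 1 \<Longrightarrow> prob_space (M n)"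
    and rv: "\<And>n. n \<ge> 1 \<Longrightarrow> \<xi> n \<in> measurable (M n) (lebesgue_Rn (k n))"
    and log_concave:
      "\<And>n. n \<ge> 1 \<Longrightarrow> log_concave_law (k n) (distr (M n) (lebesgue_Rn (k n)) (\<xi> n))"
    and isotropic:
      "\<And>n. n \<ge> 1 \<Longrightarrow> isotropic_law (k n) (distr (M n) (lebesgue_Rn (k n)) (\<xi> n))"
    and LDP:
      "satisfies_LDP M (\<lambda>n \<omega>. L2_set (\<xi> n \<omega>) {..<k n} / sqrt (real (k n))) s I"
    and cases:
      "(s \<in> o(\<lambda>n. sqrt (real (k n))) \<and> I \<noteq> singular_rate) \<or>
       ((\<exists>c1>0. \<exists>c2>0. \<forall>n\<ge>1. c1 * s n \<le> sqrt (real (k n)) \<and> sqrt (real (k n)) \<le> c2 * s n) \<and>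
        (\<exists>t0>1. (INF t\<in>{t0<..}. (INF x\<in>{t<..}. I x) / ereal t) = 0))"
  shows "\<not> KLS_conjecture"
proof
  assume KLS_conjecture
  then obtain A c where "0 < A" "0 < c" and conc:
    "\<And>n \<mu> v. 1 \<le> n \<Longrightarrow> log_concave_law n \<mu> \<Longrightarrow> isotropic_law n \<mu> \<Longrightarrow>
      measure \<mu> {x\<in>space \<mu>. v < \<bar>L2_set x {..<n} - sqrt (real n)\<bar>} \<le> exp (A - c * v)"
    by (rule KLS_norm_concentration) blast
  let ?X = "\<lambda>n \<omega>. L2_set (\<xi> n \<omega>) {..<k n} / sqrt (real (k n))"
  have X_meas: "?X n \<in> borel_measurable (M n)" and s_pos: "0 < s n" if "1 \<le> n" for n
    using LDP that by (auto simp: satisfies_LDP_def)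
  have I_nonneg: "0 \<le> I x" for x
    using LDP by (auto simp: satisfies_LDP_def rate_function_def)
  have X_conc: "measure (M n) {\<omega>\<in>space (M n). \<delta> < \<bar>?X n \<omega> - 1\<bar>} \<le> exp (A - c * \<delta> * sqrt (real (k n)))"
    if n: "1 \<le> n" for n \<delta>
  proof -
    let ?\<mu> = "distr (M n) (lebesgue_Rn (k n)) (\<xi> n)"
    have kn: "1 \<le> k n" using k_bounds[OF n] by simp
    then have sq: "0 < sqrt (real (k n))" by simp
    have "{x\<in>space ?\<mu>. \<delta> * sqrt (real (k n)) < \<bar>L2_set x {..<k n} - sqrt (real (k n))\<bar>} \<in> sets ?\<mu>"
      by measurable
    then have "measure ?\<mu> {x\<in>space ?\<mu>. \<delta> * sqrt (real (k n)) < \<bar>L2_set x {..<k n} - sqrt (real (k n))\<bar>}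
      = measure (M n) (\<xi> n -` {x\<in>space ?\<mu>. \<delta> * sqrt (real (k n)) < \<bar>L2_set x {..<k n} - sqrt (real (k n))\<bar>}
          \<inter> space (M n))"
      by (intro measure_distr rv[OF n]) simp
    also have "\<xi> n -` {x\<in>space ?\<mu>. \<delta> * sqrt (real (k n)) < \<bar>L2_set x {..<k n} - sqrt (real (k n))\<bar>}
          \<inter> space (M n) = {\<omega>\<in>space (M n). \<delta> < \<bar>?X n \<omega> - 1\<bar>}"
    proof -
      have "\<delta> < \<bar>y / sqrt (real (k n)) - 1\<bar> \<longleftrightarrow> \<delta> * sqrt (real (k n)) < \<bar>y - sqrt (real (k n))\<bar>" for y
      proof -
        have "\<bar>y / sqrt (real (k n)) - 1\<bar> = \<bar>(y - sqrt (real (k n))) / sqrt (real (k n))\<bar>"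
          using sq by (simp add: diff_divide_distrib)
        also have "\<dots> = \<bar>y - sqrt (real (k n))\<bar> / sqrt (real (k n))"
          using sq by (simp add: abs_divide)
        finally show ?thesis using sq by (simp add: pos_less_divide_eq)
      qed
      then show ?thesis
        using measurable_space[OF rv[OF n]] by auto
    qed
    finally show ?thesis
      using conc[OF kn log_concave[OF n] isotropic[OF n], of "\<delta> * sqrt (real (k n))"]
      by (simp add: mult.assoc)
  qed
  have sqrt_k: "filterlim (\<lambda>n. sqrt (real (k n))) at_top sequentially"
  proof -
    have "filterlim (\<lambda>n. norm (real (k n) / 1)) at_top sequentially"
      using k_omega by (intro smallomegaD_filterlim_at_top_norm) auto
    then show ?thesis
      by (intro filterlim_compose[OF sqrt_at_top]) simp
  qed
  from cases show False
  proof (elim disjE conjE exE)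
    assume s_small: "s \<in> o(\<lambda>n. sqrt (real (k n)))" and "I \<noteq> singular_rate"
    have ratio: "filterlim (\<lambda>n. sqrt (real (k n)) / s n) at_top sequentially"
    proof -
      have "(\<lambda>n. s n / sqrt (real (k n))) \<longlonglongrightarrow> 0"
        using s_small by (rule smalloD_tendsto)
      moreover have "\<forall>\<^sub>F n in sequentially. 0 < s n / sqrt (real (k n))"
        using eventually_ge_at_top[of 1]
        by eventually_elim (use s_pos k_bounds in force)
      ultimately have "filterlim (\<lambda>n. inverse (s n / sqrt (real (k n)))) at_top sequentially"
        by (rule filterlim_inverse_at_top)
      then show ?thesis by (simp add: inverse_eq_divide)
    qed
    \<comment> \<open>\<open>\<bar>x - 1\<bar> / 2\<close> is a radius that leaves \<open>x\<close> in the open region away from \<open>1\<close>.\<close>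
    have I_infinite: "I x = \<infinity>" if "x \<noteq> 1" for x
    proof -
      define \<delta> where "\<delta> = \<bar>x - 1\<bar> / 2"
      have \<delta>: "0 < \<delta>" "\<delta> < \<bar>x - 1\<bar>" using that by (auto simp: \<delta>_def)
      let ?B = "{y::real. \<delta> < \<bar>y - 1\<bar>}"
      have "open ?B" by (intro open_Collect_less continuous_intros)
      moreover have "\<forall>\<^sub>F n in sequentially. measure (M n) {\<omega>\<in>space (M n). ?X n \<omega> \<in> ?B}
          \<le> exp (A - c * \<delta> * sqrt (real (k n)))"
        using eventually_ge_at_top[of 1] by eventually_elim (use X_conc in simp)
      moreover have "(\<lambda>n. ereal ((A - c * \<delta> * sqrt (real (k n))) / s n)) \<longlonglongrightarrow> - \<infinity>"
      proof -
        have "(\<lambda>n. A / sqrt (real (k n)) - c * \<delta>) \<longlonglongrightarrow> 0 - c * \<delta>"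
          by (intro tendsto_diff tendsto_const tendsto_divide_0[OF tendsto_const]
              filterlim_at_top_imp_at_infinity sqrt_k)
        then have "filterlim (\<lambda>n. (A / sqrt (real (k n)) - c * \<delta>) * (sqrt (real (k n)) / s n)) at_bot sequentially"
          by (rule filterlim_tendsto_neg_mult_at_bot) (use \<open>0 < c\<close> \<delta> ratio in auto)
        moreover have "\<forall>\<^sub>F n in sequentially.
            (A / sqrt (real (k n)) - c * \<delta>) * (sqrt (real (k n)) / s n) = (A - c * \<delta> * sqrt (real (k n))) / s n"
          using eventually_ge_at_top[of 1]
        proof eventually_elim
          case (elim n)
          then show ?case using k_bounds[of n] s_pos[of n] by (simp add: field_simps)
        qed
        ultimately have "filterlim (\<lambda>n. (A - c * \<delta> * sqrt (real (k n))) / s n) at_bot sequentially"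
          by (rule filterlim_cong[OF refl refl, THEN iffD1, rotated])
        then show ?thesis by (simp add: tendsto_MInfty filterlim_at_bot_dense)
      qed
      ultimately have "\<infinity> \<le> (INF y\<in>?B. I y)" by (rule LDP_open_lower_bound[OF LDP])
      also have "\<dots> \<le> I x" by (rule INF_lower) (use \<delta> in simp)
      finally show ?thesis by simp
    qed
    have "I 1 \<le> (INF x. I x)"
    proof (rule INF_greatest)
      show "I 1 \<le> I x" for x using I_infinite[of x] by (cases "x = 1") auto
    qed
    then have "I 1 = 0" using LDP_rate_inf[OF LDP] I_nonneg[of 1] by auto
    then have "I = singular_rate"
      using I_infinite by (auto simp: singular_rate_def fun_eq_iff)
    with \<open>I \<noteq> singular_rate\<close> show False by simp
  next
    fix c1 c2 t0 :: real
    assume c12: "0 < c1" "0 < c2" and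
      comparable: "\<forall>n\<ge>1. c1 * s n \<le> sqrt (real (k n)) \<and> sqrt (real (k n)) \<le> c2 * s n"
      and t0: "1 < t0" and INF0: "(INF t\<in>{t0<..}. (INF x\<in>{t<..}. I x) / ereal t) = 0"
    have s_top: "filterlim s at_top sequentially"
    proof (rule filterlim_at_top_mono)
      show "filterlim (\<lambda>n. sqrt (real (k n)) * (1 / c2)) at_top sequentially"
        by (rule filterlim_at_top_mult_tendsto_pos[OF tendsto_const _ sqrt_k]) (use c12 in simp)
      show "\<forall>\<^sub>F n in sequentially. sqrt (real (k n)) * (1 / c2) \<le> s n"
        using eventually_ge_at_top[of 1]
        by eventually_elim (use comparable c12 in \<open>auto simp: field_simps\<close>)
    qed
    \<comment> \<open>The bound on the rate is \<open>c * c1 * (t - 1)\<close>; for \<open>t > t0 > 1\<close> it dominates a multiple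
      of \<open>t\<close>, since \<open>t - 1 \<ge> (1 - 1 / t0) * t\<close>.\<close>
    define \<kappa> where "\<kappa> = c * c1 * (1 - 1 / t0)"
    have \<kappa>: "0 < \<kappa>" using \<open>0 < c\<close> c12 t0 by (simp add: \<kappa>_def)
    have "ereal \<kappa> \<le> (INF t\<in>{t0<..}. (INF x\<in>{t<..}. I x) / ereal t)"
    proof (rule INF_greatest)
      fix t assume "t \<in> {t0<..}"
      then have t: "t0 < t" "1 < t" using t0 by auto
      let ?l = "c * c1 * (t - 1)"
      have "open {t<..}" by simp
      moreover have "\<forall>\<^sub>F n in sequentially. measure (M n) {\<omega>\<in>space (M n). ?X n \<omega> \<in> {t<..}}
          \<le> exp (A - ?l * s n)"
        \<comment> \<open>\<open>sqrt (k n)\<close> is weakened to \<open>c1 * s n\<close> because only the latter has a limit after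
          division by \<open>s n\<close>.\<close>
        using eventually_ge_at_top[of 1]
      proof eventually_elim
        case (elim n)
        interpret prob_space "M n" using prob[OF elim] .
        note [measurable] = X_meas[OF elim]
        have "measure (M n) {\<omega>\<in>space (M n). ?X n \<omega> \<in> {t<..}}
            \<le> measure (M n) {\<omega>\<in>space (M n). t - 1 < \<bar>?X n \<omega> - 1\<bar>}"
          by (rule finite_measure_mono) auto
        also have "\<dots> \<le> exp (A - c * (t - 1) * sqrt (real (k n)))"
          by (rule X_conc[OF elim])
        also have "\<dots> \<le> exp (A - ?l * s n)"
        proof -
          have "c * (t - 1) * (c1 * s n) \<le> c * (t - 1) * sqrt (real (k n))"
            by (rule mult_left_mono) (use comparable elim \<open>0 < c\<close> t in auto)
          then show ?thesis by (simp add: mult_ac)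
        qed
        finally show ?case .
      qed
      moreover have "(\<lambda>n. ereal ((A - ?l * s n) / s n)) \<longlonglongrightarrow> - ereal ?l"
      proof -
        have "(\<lambda>n. A / s n - ?l) \<longlonglongrightarrow> 0 - ?l"
          by (intro tendsto_diff tendsto_const tendsto_divide_0[OF tendsto_const]
              filterlim_at_top_imp_at_infinity s_top)
        moreover have "\<forall>\<^sub>F n in sequentially. A / s n - ?l = (A - ?l * s n) / s n"
          using eventually_ge_at_top[of 1]
        proof eventually_elim
          case (elim n)
          then show ?case using s_pos[of n] by (simp add: diff_divide_distrib)
        qed
        ultimately have "(\<lambda>n. (A - ?l * s n) / s n) \<longlonglongrightarrow> - ?l"
          using tendsto_cong by fastforce
        then have "(\<lambda>n. ereal ((A - ?l * s n) / s n)) \<longlonglongrightarrow> ereal (- ?l)"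
          by (rule tendsto_ereal)
        then show ?thesis by simp
      qed
      ultimately have "ereal ?l \<le> (INF x\<in>{t<..}. I x)" by (rule LDP_open_lower_bound[OF LDP])
      moreover have "t * \<kappa> \<le> ?l"
      proof -
        have "t * (1 - 1 / t0) \<le> t - 1" using t t0 by (simp add: field_simps)
        then have "c * c1 * (t * (1 - 1 / t0)) \<le> c * c1 * (t - 1)"
          by (rule mult_left_mono) (use \<open>0 < c\<close> c12 in simp)
        then show ?thesis by (simp add: \<kappa>_def mult_ac)
      qed
      ultimately have "ereal t * ereal \<kappa> \<le> (INF x\<in>{t<..}. I x)"
        by (simp add: order_trans[of "ereal (t * \<kappa>)" "ereal ?l"])
      then show "ereal \<kappa> \<le> (INF x\<in>{t<..}. I x) / ereal t"
        using t by (simp add: ereal_le_divide_pos)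
    qed
    then show False using INF0 \<kappa> by simp
  qed
qed

end
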